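(* Let $\mathbb{K}$ be a field of characteristic zero and let $\mathcal{D}\subset\mathbb{Z}_+^3$ be a finite set of lattice points such that $\mathbf{I}_2(\mathcal{D})$ is lexicographically quadratic. Let $\mathcal{G}\subset\mathcal{D}$ be a subset satisfying one of the following conditions. (Detaching Condition) For any $\boldsymbol v_1,\boldsymbol v_2\in\mathcal{G}$ such that $T_{\boldsymbol v_1}T_{\boldsymbol v_2}-T_{\boldsymbol v_1'}T_{\boldsymbol v_2'}\in\mathbf{I}_2(\mathcal{D})$ (with $\boldsymbol v_1',\boldsymbol v_2'\in\mathcal{D}$), one always has $\boldsymbol v_1',\boldsymbol v_2'\in\mathcal{G}$. (Leading Monomial Condition) $\mathcal{G}=\mathcal{D}\setminus\{\boldsymbol u\}$ for some $\boldsymbol u\in\mathcal{D}$, and for each $\boldsymbol v\in\mathcal{G}$ and each nonzero binomial $T_{\boldsymbol u}T_{\boldsymbol v}-T_{\boldsymbol u'}T_{\boldsymbol v'}\in\mathbf{I}_2(\mathcal{D})$, the monomial $T_{\boldsymbol u}T_{\boldsymbol v}$ is the leading monomial of this binomial. Then the following restriction formulas hold: $$\mathbf{I}_2(\mathcal{D})\cap\mathbb{K}[\mathbf{T}_{\mathcal{G}}]=\mathbf{I}_2(\mathcal{G})\quad\text{and}\quad\mathrm{gens}(\mathrm{in}(\mathbf{I}_2(\mathcal{D})))\cap\mathbb{K}[\mathbf{T}_{\mathcal{G}}]=\mathrm{gens}(\mathrm{in}(\mathbf{I}_2(\mathcal{G}))).$$ In particular, $\mathbf{I}_2(\mathcal{G})$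 is lexicographically quadratic.
   Context: For a finite $\mathcal{G}\subset\mathbb{Z}_+^3$ let $\mathbb{K}[\mathbf{T}_{\mathcal{G}}]=\mathbb{K}[T_{\boldsymbol u}:\boldsymbol u\in\mathcal{G}]$. For $\boldsymbol u=(i_1,j_1,k_1)$, $\boldsymbol v=(i_2,j_2,k_2)$ in $\mathcal{G}$ put $\mathbf{I}_{2,x}(\boldsymbol u,\boldsymbol v)=T_{\boldsymbol u}T_{\boldsymbol v}-T_{i_2,j_1,k_1}T_{i_1,j_2,k_2}$ if both $(i_2,j_1,k_1),(i_1,j_2,k_2)\in\mathcal{G}$, and $0$ otherwise; $\mathbf{I}_{2,y},\mathbf{I}_{2,z}$ are analogous, switching second, respectively third, coordinates. The 2-minors ideal $\mathbf{I}_2(\mathcal{G})\subset\mathbb{K}[\mathbf{T}_{\mathcal{G}}]$ is generated by all these binomials, $\boldsymbol u,\boldsymbol v\in\mathcal{G}$. Variables are ordered by $T_{i,j,k}>T_{i',j',k'}$ iff $(i,j,k)$ precedes $(i',j',k')$ lexicographically, and monomials by the induced lexicographic order; leading monomials and initial ideals $\mathrm{in}(\cdot)$ refer to this order. For a monomial ideal $I$, $\mathrm{gens}(I)$ is its set of minimal monomial generators. A binomial ideal is lexicographically quadratic if all elements of its minimal Gr\"obner basis with respect to this lexicographic order are quadratic. *)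

theory Defs
  imports "HOL-Library.Poly_Mapping" "HOL-Library.Product_Lexorder" "HOL-Algebra.Ideal"
begin

section \<open>Polynomial rings over finite sets of lattice points\<close>

text \<open>
  A monomial is given by its exponent vector, of type \<open>point \<Rightarrow>\<^sub>0 nat\<close>, and a polynomial is a
  finitely supported map from exponent vectors to coefficients.  All the rings
  \<open>K[T_u : u \<in> G]\<close> live on this one type; they differ in their carriers.
\<close>

type_synonym point = "nat \<times> nat \<times> nat"

type_synonym expo = "point \<Rightarrow>\<^sub>0 nat"

type_synonym 'k tpoly = "expo \<Rightarrow>\<^sub>0 'k"

definition poly_ring :: "point set \<Rightarrow> 'k::field tpoly ring" where
  "poly_ring G =
    \<lparr>carrier = {p. \<forall>m \<in> Poly_Mapping.keys p. Poly_Mapping.keys m \<subseteq> G},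
     monoid.mult = (*), one = 1, zero = 0, add = (+)\<rparr>"

definition monomial :: "expo \<Rightarrow> 'k::field tpoly" where
  "monomial m = Poly_Mapping.single m 1"

definition var :: "point \<Rightarrow> 'k::field tpoly" where
  "var u = monomial (Poly_Mapping.single u 1)"


section \<open>The 2-minors ideal\<close>

fun minor_x :: "point set \<Rightarrow> point \<Rightarrow> point \<Rightarrow> 'k::field tpoly" where
  "minor_x G (i1, j1, k1) (i2, j2, k2) =
    (if (i2, j1, k1) \<in> G \<and> (i1, j2, k2) \<in> G
     then var (i1, j1, k1) * var (i2, j2, k2) - var (i2, j1, k1) * var (i1, j2, k2) else 0)"

fun minor_y :: "point set \<Rightarrow> point \<Rightarrow> point \<Rightarrow> 'k::field tpoly" where
  "minor_y G (i1, j1, k1) (i2, j2, k2) =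
    (if (i1, j2, k1) \<in> G \<and> (i2, j1, k2) \<in> G
     then var (i1, j1, k1) * var (i2, j2, k2) - var (i1, j2, k1) * var (i2, j1, k2) else 0)"

fun minor_z :: "point set \<Rightarrow> point \<Rightarrow> point \<Rightarrow> 'k::field tpoly" where
  "minor_z G (i1, j1, k1) (i2, j2, k2) =
    (if (i1, j1, k2) \<in> G \<and> (i2, j2, k1) \<in> G
     then var (i1, j1, k1) * var (i2, j2, k2) - var (i1, j1, k2) * var (i2, j2, k1) else 0)"

definition minors_ideal :: "point set \<Rightarrow> 'k::field tpoly set" where
  "minors_ideal G =
    Idl\<^bsub>poly_ring G\<^esub> (\<Union>u \<in> G. \<Union>v \<in> G. {minor_x G u v, minor_y G u v, minor_z G u v})"


section \<open>Leading monomials, initial ideals and Groebner bases\<close>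

text \<open>
  Exponent vectors carry the library's linear order on \<open>\<Rightarrow>\<^sub>0\<close>: two of them are compared at the
  smallest point where they differ, points being ordered lexicographically.  This is the
  lexicographic monomial order in which \<open>T_u > T_v\<close> if and only if \<open>u\<close> precedes \<open>v\<close>.
\<close>

lemma expo_less_iff:
  "(m :: expo) < m' \<longleftrightarrow>
    (\<exists>u. Poly_Mapping.lookup m u < Poly_Mapping.lookup m' u \<and>
         (\<forall>v < u. Poly_Mapping.lookup m v = Poly_Mapping.lookup m' v))"
  by (simp add: less_poly_mapping.rep_eq less_fun_def)

lemma single_less_single_iff:
  "Poly_Mapping.single v (1::nat) < Poly_Mapping.single u 1 \<longleftrightarrow> u < (v :: point)"
proof
  assume "Poly_Mapping.single v (1::nat) < Poly_Mapping.single u 1"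
  then obtain w where w: "Poly_Mapping.lookup (Poly_Mapping.single v (1::nat)) w
      < Poly_Mapping.lookup (Poly_Mapping.single u 1) w"
    and b: "\<forall>w' < w. Poly_Mapping.lookup (Poly_Mapping.single v (1::nat)) w' =
      Poly_Mapping.lookup (Poly_Mapping.single u 1) w'"
    unfolding expo_less_iff by blast
  from w have "w = u" "v \<noteq> u" by (auto simp: lookup_single when_def split: if_splits)
  with b show "u < v" by (metis lookup_single_eq lookup_single_not_eq neq_iff zero_neq_one)
next
  assume "u < v"
  then show "Poly_Mapping.single v (1::nat) < Poly_Mapping.single u 1"
    unfolding expo_less_iff
    by (intro exI[of _ u]) (auto simp: lookup_single when_def)
qed

definition lead_expo :: "'k::field tpoly \<Rightarrow> expo" where
  "lead_expo p = Max (Poly_Mapping.keys p)"  \<comment> \<open>meaningful for \<open>p \<noteq> 0\<close> only\<close>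

definition lead_mon :: "'k::field tpoly \<Rightarrow> 'k tpoly" where
  "lead_mon p = monomial (lead_expo p)"

definition initial_ideal :: "point set \<Rightarrow> 'k::field tpoly set \<Rightarrow> 'k tpoly set" where
  "initial_ideal G I = Idl\<^bsub>poly_ring G\<^esub> (lead_mon ` (I - {0}))"

text \<open>
  The minimal monomial generators of a monomial ideal are the monomials in it that are minimal
  with respect to divisibility.  Lemma \<open>min_gens_minimal\<close> below shows that they form the smallest
  set of monomials that generates the ideal.
\<close>

definition min_gens :: "'k::field tpoly set \<Rightarrow> 'k tpoly set" where
  "min_gens J = {monomial m | m. monomial m \<in> J \<and>
    (\<forall>m'. monomial m' \<in> J \<and> monomial m' dvd (monomial m :: 'k tpoly) \<longrightarrow> m' = m)}"

definition groebner_basis :: "point set \<Rightarrow> 'k::field tpoly set \<Rightarrow> 'k tpoly set \<Rightarrow> bool" where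
  "groebner_basis G I B \<longleftrightarrow>
    finite B \<and> B \<subseteq> I - {0} \<and> Idl\<^bsub>poly_ring G\<^esub> (lead_mon ` B) = initial_ideal G I"

definition minimal_groebner_basis :: "point set \<Rightarrow> 'k::field tpoly set \<Rightarrow> 'k tpoly set \<Rightarrow> bool" where
  "minimal_groebner_basis G I B \<longleftrightarrow>
    groebner_basis G I B \<and>
    (\<forall>g \<in> B. Poly_Mapping.lookup g (lead_expo g) = 1) \<and>
    (\<forall>g \<in> B. \<forall>h \<in> B. g \<noteq> h \<longrightarrow> \<not> lead_mon h dvd lead_mon g)"

definition total_degree :: "expo \<Rightarrow> nat" where
  "total_degree m = (\<Sum>u \<in> Poly_Mapping.keys m. Poly_Mapping.lookup m u)"

definition quadratic :: "'k::field tpoly \<Rightarrow> bool" where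
  "quadratic p \<longleftrightarrow> p \<noteq> 0 \<and> (\<forall>m \<in> Poly_Mapping.keys p. total_degree m = 2)"

text \<open>
  A minimal Groebner basis is unique only up to its non-leading terms.  Since the order is not
  degree-compatible, adding to a basis element an ideal element of higher degree with smaller
  leading monomial gives another minimal Groebner basis, so even a homogeneous ideal can have
  minimal Groebner bases with inhomogeneous elements.  Hence we ask for one minimal Groebner
  basis that is quadratic, not for all of them to be.
\<close>

definition lex_quadratic :: "point set \<Rightarrow> 'k::field tpoly set \<Rightarrow> bool" where
  "lex_quadratic G I \<longleftrightarrow> (\<exists>B. minimal_groebner_basis G I B \<and> (\<forall>g \<in> B. quadratic g))"


section \<open>The two conditions on a subset\<close>

definition detaching_condition :: "'k::field itself \<Rightarrow> point set \<Rightarrow> point set \<Rightarrow> bool" where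
  "detaching_condition _ D G \<longleftrightarrow>
    (\<forall>v1 \<in> G. \<forall>v2 \<in> G. \<forall>v1' \<in> D. \<forall>v2' \<in> D.
      var v1 * var v2 - var v1' * var v2' \<in> (minors_ideal D :: 'k tpoly set) \<longrightarrow>
      v1' \<in> G \<and> v2' \<in> G)"

definition leading_monomial_condition :: "'k::field itself \<Rightarrow> point set \<Rightarrow> point set \<Rightarrow> bool" where
  "leading_monomial_condition _ D G \<longleftrightarrow>
    (\<exists>u \<in> D. G = D - {u} \<and>
      (\<forall>v \<in> G. \<forall>u' \<in> D. \<forall>v' \<in> D.
        var u * var v - var u' * var v' \<in> (minors_ideal D :: 'k tpoly set) \<and>
        var u * var v - var u' * var v' \<noteq> (0 :: 'k tpoly) \<longrightarrow>
        lead_mon (var u * var v - var u' * var v') = (var u * var v :: 'k tpoly)))"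


section \<open>Minimal monomial generators\<close>

lemma poly_ring_simps [simp]:
  "carrier (poly_ring G) = {p. \<forall>m \<in> Poly_Mapping.keys p. Poly_Mapping.keys m \<subseteq> G}"
  "p \<otimes>\<^bsub>poly_ring G\<^esub> q = p * q" "p \<oplus>\<^bsub>poly_ring G\<^esub> q = p + q"
  "\<one>\<^bsub>poly_ring G\<^esub> = 1" "\<zero>\<^bsub>poly_ring G\<^esub> = 0"
  by (simp_all add: poly_ring_def)

lemma keys_mult_mem:
  assumes "m \<in> Poly_Mapping.keys (p * q :: 'k::field tpoly)"
  obtains a b where "a \<in> Poly_Mapping.keys p" "b \<in> Poly_Mapping.keys q" "m = a + b"
  using subsetD[OF Poly_Mapping.keys_mult assms] that by auto

lemma cring_poly_ring: "cring (poly_ring G :: 'k::field tpoly ring)"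
proof -
  have add: "p + q \<in> carrier (poly_ring G)"
    if "p \<in> carrier (poly_ring G)" "q \<in> carrier (poly_ring G)" for p q :: "'k tpoly"
    using that Poly_Mapping.keys_add[of p q] by auto
  have mult: "p * q \<in> carrier (poly_ring G)"
    if pq: "p \<in> carrier (poly_ring G)" "q \<in> carrier (poly_ring G)" for p q :: "'k tpoly"
  proof -
    have "Poly_Mapping.keys m \<subseteq> G" if m: "m \<in> Poly_Mapping.keys (p * q)" for m
    proof -
      obtain a b where ab: "a \<in> Poly_Mapping.keys p" "b \<in> Poly_Mapping.keys q" "m = a + b"
        using m by (rule keys_mult_mem)
      then show ?thesis using Poly_Mapping.keys_add[of a b] pq by auto
    qed
    then show ?thesis by simp
  qed
  have uminus: "- p \<in> carrier (poly_ring G)" if "p \<in> carrier (poly_ring G)" for p :: "'k tpoly"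
    using that by (simp add: in_keys_iff)
  show ?thesis
  proof (rule cringI)
    show "abelian_group (poly_ring G :: 'k tpoly ring)"
    proof (rule abelian_groupI)
      fix p :: "'k tpoly" assume "p \<in> carrier (poly_ring G)"
      with uminus show "\<exists>q \<in> carrier (poly_ring G). q \<oplus>\<^bsub>poly_ring G\<^esub> p = \<zero>\<^bsub>poly_ring G\<^esub>"
        by (intro bexI[of _ "- p"]) auto
    next
      fix p q :: "'k tpoly" assume "p \<in> carrier (poly_ring G)" "q \<in> carrier (poly_ring G)"
      then show "p \<oplus>\<^bsub>poly_ring G\<^esub> q \<in> carrier (poly_ring G)"
        unfolding poly_ring_simps(3) by (rule add)
    qed (simp_all add: add.assoc add.commute)
    show "comm_monoid (poly_ring G :: 'k tpoly ring)"
    proof (rule comm_monoidI)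
      fix p q :: "'k tpoly" assume "p \<in> carrier (poly_ring G)" "q \<in> carrier (poly_ring G)"
      then show "p \<otimes>\<^bsub>poly_ring G\<^esub> q \<in> carrier (poly_ring G)"
        unfolding poly_ring_simps(2) by (rule mult)
    qed (simp_all add: mult.assoc mult.commute)
  qed (simp add: distrib_right)
qed

lemma monomial_dvd_monomial_iff: "monomial a dvd (monomial b :: 'k::field tpoly) \<longleftrightarrow> (\<exists>c. b = a + c)"
proof
  assume "monomial a dvd (monomial b :: 'k tpoly)"
  then obtain q where q: "(monomial b :: 'k tpoly) = monomial a * q" ..
  have "b \<in> Poly_Mapping.keys (monomial a * q)" unfolding q[symmetric] by (simp add: monomial_def)
  then obtain a' c where "a' \<in> Poly_Mapping.keys (monomial a :: 'k tpoly)" "b = a' + c"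
    by (rule keys_mult_mem)
  then show "\<exists>c. b = a + c" by (auto simp: monomial_def)
next
  assume "\<exists>c. b = a + c"
  then obtain c where "b = a + c" ..
  then have "(monomial b :: 'k tpoly) = monomial a * monomial c" by (simp add: monomial_def mult_single)
  then show "monomial a dvd (monomial b :: 'k tpoly)" by simp
qed

lemma min_gens_minimal:
  fixes M :: "'k::field tpoly set"
  assumes M: "M \<subseteq> carrier (poly_ring G)" "M \<subseteq> Set.range monomial"
    and J: "J = Idl\<^bsub>poly_ring G\<^esub> M"
  shows "Idl\<^bsub>poly_ring G\<^esub> (min_gens J) = J" and "min_gens J \<subseteq> M"
proof -
  interpret R: cring "poly_ring G :: 'k tpoly ring" by (rule cring_poly_ring)
  interpret J: ideal J "poly_ring G :: 'k tpoly ring"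
    unfolding J by (rule R.genideal_ideal[OF M(1)])
  have MJ: "M \<subseteq> J" unfolding J by (rule R.genideal_self[OF M(1)])
  have Jcarr: "J \<subseteq> carrier (poly_ring G)" using J.a_subset by blast
  define S where "S = {p \<in> carrier (poly_ring G :: 'k tpoly ring).
    \<forall>m \<in> Poly_Mapping.keys p. \<exists>a c. monomial a \<in> M \<and> m = a + c}"
  have mult: "q * p \<in> S" if "p \<in> S" "q \<in> carrier (poly_ring G)" for p q
  proof -
    have "q * p \<in> carrier (poly_ring G)"
      using R.m_closed[of q p] that unfolding S_def by simp
    moreover have "\<exists>a c. monomial a \<in> M \<and> m = a + c" if m: "m \<in> Poly_Mapping.keys (q * p)" for m
    proof -
      obtain x y where xy: "x \<in> Poly_Mapping.keys q" "y \<in> Poly_Mapping.keys p" "m = x + y"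
        using m by (rule keys_mult_mem)
      with \<open>p \<in> S\<close> obtain a c where "monomial a \<in> M" "y = a + c" unfolding S_def by blast
      then show ?thesis using xy by (intro exI[of _ a] exI[of _ "c + x"]) (simp add: add_ac)
    qed
    ultimately show ?thesis by (simp add: S_def)
  qed
  have "ideal S (poly_ring G :: 'k tpoly ring)"
  proof (rule idealI[OF R.ring_axioms])
    show "subgroup S (add_monoid (poly_ring G :: 'k tpoly ring))"
    proof (rule R.add.subgroupI)
      fix p assume p: "p \<in> S"
      have "\<ominus>\<^bsub>poly_ring G\<^esub> p = - p"
        by (rule R.minus_equality) (use p in \<open>auto simp: S_def in_keys_iff\<close>)
      then show "\<ominus>\<^bsub>poly_ring G\<^esub> p \<in> S" using p by (auto simp: S_def in_keys_iff)
    next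
      fix p q assume "p \<in> S" "q \<in> S"
      then show "p \<oplus>\<^bsub>poly_ring G\<^esub> q \<in> S"
        using R.a_closed[of p q] subsetD[OF Poly_Mapping.keys_add[of p q]]
        unfolding S_def by simp blast
    qed (auto simp: S_def intro: exI[of _ 0])
  qed (use mult in \<open>auto simp: mult.commute\<close>)
  moreover have "M \<subseteq> S"
  proof
    fix p assume p: "p \<in> M"
    with M obtain a where "p = monomial a" by blast
    then have keys: "Poly_Mapping.keys p = {a}" by (simp add: monomial_def)
    have "\<exists>a' c. monomial a' \<in> M \<and> a = a' + c"
      by (rule exI[of _ a], rule exI[of _ 0]) (use p \<open>p = monomial a\<close> in simp)
    moreover have "p \<in> carrier (poly_ring G)" using p M(1) by blast
    ultimately show "p \<in> S" unfolding S_def by (simp add: keys)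
  qed
  ultimately have JS: "J \<subseteq> S" unfolding J by (rule R.genideal_minimal)
  have below: "\<exists>a. monomial a \<in> M \<and> monomial a dvd (monomial m :: 'k tpoly)" if "monomial m \<in> J" for m
  proof -
    have "monomial m \<in> S" using that JS by blast
    moreover have "Poly_Mapping.keys (monomial m :: 'k tpoly) = {m}" by (simp add: monomial_def)
    ultimately show ?thesis unfolding S_def monomial_dvd_monomial_iff by simp
  qed
  show "min_gens J \<subseteq> M"
    using below MJ unfolding min_gens_def by blast
  have gJ: "min_gens J \<subseteq> J" by (auto simp: min_gens_def)
  interpret H: ideal "Idl\<^bsub>poly_ring G\<^esub> (min_gens J)" "poly_ring G :: 'k tpoly ring"
    by (rule R.genideal_ideal) (use gJ Jcarr in blast)
  have gH: "min_gens J \<subseteq> Idl\<^bsub>poly_ring G\<^esub> (min_gens J)"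
    by (rule R.genideal_self) (use gJ Jcarr in blast)
  have in_H: "(monomial m :: 'k tpoly) \<in> Idl\<^bsub>poly_ring G\<^esub> (min_gens J)" if "monomial m \<in> J" for m
    using that
  proof (induction "sum (Poly_Mapping.lookup m) (Poly_Mapping.keys m)" arbitrary: m
      rule: less_induct)
    case less
    show ?case
    proof (cases "monomial m \<in> min_gens J")
      case True
      then show ?thesis using gH by blast
    next
      case False
      then obtain a where a: "monomial a \<in> J" "monomial a dvd (monomial m :: 'k tpoly)" "a \<noteq> m"
        using less.prems by (auto simp: min_gens_def)
      then obtain c where c: "m = a + c" unfolding monomial_dvd_monomial_iff by blast
      have keys: "Poly_Mapping.keys m = Poly_Mapping.keys a \<union> Poly_Mapping.keys c"
        unfolding c by (auto simp: in_keys_iff lookup_add)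
      have "c \<noteq> 0" using a c by auto
      then obtain u where u: "u \<in> Poly_Mapping.keys c"
        using keys_eq_empty by blast
      have "sum (Poly_Mapping.lookup a) (Poly_Mapping.keys a) =
          sum (Poly_Mapping.lookup a) (Poly_Mapping.keys m)"
        by (rule sum.mono_neutral_left) (auto simp: keys in_keys_iff)
      also have "\<dots> < sum (Poly_Mapping.lookup m) (Poly_Mapping.keys m)"
      proof (rule sum_strict_mono_ex1)
        show "\<forall>v \<in> Poly_Mapping.keys m. Poly_Mapping.lookup a v \<le> Poly_Mapping.lookup m v"
          by (simp add: c lookup_add)
        have "u \<in> Poly_Mapping.keys m" using u keys by blast
        moreover have "Poly_Mapping.lookup a u < Poly_Mapping.lookup m u"
          using u by (simp add: c lookup_add in_keys_iff)
        ultimately show "\<exists>v \<in> Poly_Mapping.keys m. Poly_Mapping.lookup a v < Poly_Mapping.lookup m v"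
          by blast
      qed simp
      finally have "monomial a \<in> Idl\<^bsub>poly_ring G\<^esub> (min_gens J)" using less.hyps a by blast
      moreover have "(monomial m :: 'k tpoly) \<in> carrier (poly_ring G)"
        using less.prems Jcarr by blast
      then have "(monomial c :: 'k tpoly) \<in> carrier (poly_ring G)"
        using keys by (simp add: monomial_def)
      ultimately have "monomial a \<otimes>\<^bsub>poly_ring G\<^esub> monomial c \<in> Idl\<^bsub>poly_ring G\<^esub> (min_gens J)"
        by (rule H.I_r_closed)
      then show ?thesis by (simp add: c monomial_def mult_single)
    qed
  qed
  show "Idl\<^bsub>poly_ring G\<^esub> (min_gens J) = J"
  proof
    show "Idl\<^bsub>poly_ring G\<^esub> (min_gens J) \<subseteq> J"
      by (rule R.genideal_minimal[OF J.ideal_axioms gJ])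
    have "M \<subseteq> Idl\<^bsub>poly_ring G\<^esub> (min_gens J)" using M(2) MJ in_H by blast
    then show "J \<subseteq> Idl\<^bsub>poly_ring G\<^esub> (min_gens J)"
      unfolding J by (rule R.genideal_minimal[OF H.ideal_axioms[unfolded J]])
  qed
qed

end

theory Submission
  imports Defs
begin

text \<open>
  A nonzero minor of \<open>D\<close> is a difference of two quadratic monomials with the same margins: for each of
  the three coordinate directions, both involve the same multiset of coordinates.  Conversely, two
  quadratic monomials with the same margins are two diagonals of one box, and any two diagonals
  of a box are related by a single switch, in the first, second or third coordinate.  So the
  minors of \<open>D\<close> are, up to zero, all the binomials \<open>T_u T_v - T_u' T_v'\<close> with equal margins and
  all four points in \<open>D\<close> (lemma \<open>pair_binomial_in_minors_ideal\<close>).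

  In an element of the ideal of minors, the coefficients of the monomials with given margins add up
  to zero.  Hence no monomial of such an element is alone with its margins
  (lemma \<open>minors_ideal_other_key\<close>), and a quadratic monomial is a leading monomial of the ideal
  exactly if some smaller quadratic monomial over the same point set has the same margins.  Call
  such monomials reducible over \<open>D\<close>.  It follows that the ideal is lexicographically quadratic if
  and only if every leading monomial is divisible by a reducible one, and that in this case the
  reducible monomials are the minimal generators of the initial ideal.

  Both conditions on \<open>G\<close> are used for one purpose (lemma \<open>reducible_pairs_restrict\<close>): a monomial
  over \<open>G\<close> that is reducible over \<open>D\<close> is reducible over \<open>G\<close>.  Once this holds, an element \<open>f\<close> of
  the ideal of \<open>D\<close> that involves only variables from \<open>G\<close> has a leading monomial divisible by a
  monomial reducible over \<open>G\<close>; subtracting a multiple of a minor of \<open>G\<close> makes the leading monomial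
  smaller without increasing degrees, so division ends with remainder zero and \<open>f\<close> lies in the ideal
  of \<open>G\<close>.  The other two claims follow by comparing the reducible monomials of \<open>D\<close> and of \<open>G\<close>.
\<close>

section \<open>Polynomials and their ideals\<close>

lemma poly_mapping_sum_singles:
  "p = (\<Sum>m \<in> Poly_Mapping.keys p. Poly_Mapping.single m (Poly_Mapping.lookup p m))"
  by (rule poly_mapping_eqI) (simp add: lookup_sum lookup_single when_def in_keys_iff)

lemma poly_mapping_additive_induct [case_names zero single add]:
  fixes p :: "'a \<Rightarrow>\<^sub>0 'b::comm_monoid_add"
  assumes "P 0" and single: "\<And>m c. P (Poly_Mapping.single m c)"
    and "\<And>p q. P p \<Longrightarrow> P q \<Longrightarrow> P (p + q)"
  shows "P p"
proof -
  have "P (\<Sum>m \<in> A. Poly_Mapping.single m (Poly_Mapping.lookup p m))" if "finite A" for A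
    using that by induction (use assms in auto)
  then show ?thesis by (subst poly_mapping_sum_singles) simp
qed

lemma keys_expo_add:
  "Poly_Mapping.keys (m + n :: expo) = Poly_Mapping.keys m \<union> Poly_Mapping.keys n"
  by (auto simp: in_keys_iff lookup_add)

lemma monomial_add: "monomial (m + n) = monomial m * (monomial n :: 'k::field tpoly)"
  by (simp add: monomial_def mult_single)

lemma keys_monomial [simp]: "Poly_Mapping.keys (monomial m :: 'k::field tpoly) = {m}"
  by (simp add: monomial_def)

lemma monomial_eq_iff [simp]: "(monomial m :: 'k::field tpoly) = monomial n \<longleftrightarrow> m = n"
  by (metis keys_monomial singleton_inject)

lemma lookup_monomial: "Poly_Mapping.lookup (monomial m :: 'k::field tpoly) n = (if m = n then 1 else 0)"
  by (simp add: monomial_def lookup_single when_def)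

lemma keys_minus_subset:
  "Poly_Mapping.keys (p - q :: 'k::field tpoly) \<subseteq> Poly_Mapping.keys p \<union> Poly_Mapping.keys q"
  by (auto simp: in_keys_iff lookup_minus)

lemma single_in_carrier:
  "Poly_Mapping.keys m \<subseteq> G \<Longrightarrow> Poly_Mapping.single m (c :: 'k::field) \<in> carrier (poly_ring G)"
  by simp

lemma ideal_poly_ring_closed:
  fixes I :: "'k::field tpoly set"
  assumes "ideal I (poly_ring G)"
  shows "0 \<in> I" "p \<in> I \<Longrightarrow> q \<in> I \<Longrightarrow> p + q \<in> I" "p \<in> I \<Longrightarrow> q \<in> carrier (poly_ring G) \<Longrightarrow> q * p \<in> I"
    "p \<in> I \<Longrightarrow> q \<in> I \<Longrightarrow> p - q \<in> I" "I \<subseteq> carrier (poly_ring G)"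
proof -
  interpret ideal I "poly_ring G" by fact
  show "0 \<in> I" using additive_subgroup.zero_closed[OF additive_subgroup_axioms] by simp
  show add: "p + q \<in> I" if "p \<in> I" "q \<in> I" for p q using additive_subgroup.a_closed[OF additive_subgroup_axioms that] by simp
  show mult: "q * p \<in> I" if "p \<in> I" "q \<in> carrier (poly_ring G)" for p q
    using I_l_closed[OF that] by simp
  show "p - q \<in> I" if "p \<in> I" "q \<in> I" for p q
  proof -
    have "Poly_Mapping.single 0 (- 1) * q \<in> I"
      by (rule mult[OF that(2)]) (rule single_in_carrier, simp)
    then have "- q \<in> I" by (simp add: single_uminus)
    then show ?thesis using add[OF that(1)] by fastforce
  qed
  show "I \<subseteq> carrier (poly_ring G)" using a_subset by blast
qed

text \<open>
  An induction principle for generated ideals.  Closure under multiplication by single terms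
  suffices, since every ring element is a sum of terms; this keeps the closure conditions easy to
  verify for sets that are described through the exponents of their elements.
\<close>

lemma genideal_poly_ring_subset:
  fixes M S :: "'k::field tpoly set"
  assumes M: "M \<subseteq> carrier (poly_ring G)" "M \<subseteq> S"
    and S: "0 \<in> S" "\<And>p q. p \<in> S \<Longrightarrow> q \<in> S \<Longrightarrow> p + q \<in> S"
      "\<And>p m c. p \<in> S \<Longrightarrow> Poly_Mapping.keys m \<subseteq> G \<Longrightarrow> Poly_Mapping.single m c * p \<in> S"
  shows "Idl\<^bsub>poly_ring G\<^esub> M \<subseteq> S"
proof -
  interpret R: cring "poly_ring G :: 'k tpoly ring" by (rule cring_poly_ring)
  let ?S = "S \<inter> carrier (poly_ring G)"
  have mult: "q * p \<in> ?S" if p: "p \<in> ?S" and q: "q \<in> carrier (poly_ring G)" for p q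
  proof -
    have "(\<Sum>m \<in> A. Poly_Mapping.single m (Poly_Mapping.lookup q m)) * p \<in> S"
      if "finite A" "A \<subseteq> Poly_Mapping.keys q" for A
      using that
    proof induction
      case (insert m A)
      have "Poly_Mapping.keys m \<subseteq> G" using insert q by simp
      then show ?case using insert S p by (simp add: distrib_right)
    qed (simp add: S)
    from this[of "Poly_Mapping.keys q"] have "q * p \<in> S"
      by (simp flip: poly_mapping_sum_singles)
    then show ?thesis using R.m_closed[of q p] p q by simp
  qed
  have uminus: "- p = Poly_Mapping.single 0 (- 1) * p" for p :: "'k tpoly"
    by (simp add: single_uminus)
  have "ideal ?S (poly_ring G :: 'k tpoly ring)"
  proof (rule idealI[OF R.ring_axioms])
    show "subgroup ?S (add_monoid (poly_ring G :: 'k tpoly ring))"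
    proof (rule R.add.subgroupI)
      fix p assume p: "p \<in> ?S"
      have "\<ominus>\<^bsub>poly_ring G\<^esub> p = - p"
        by (rule R.minus_equality) (use p in \<open>auto simp: in_keys_iff\<close>)
      then show "\<ominus>\<^bsub>poly_ring G\<^esub> p \<in> ?S"
        using mult[OF p single_in_carrier[of 0 G "- 1"]] uminus[of p] by simp
    next
      fix p q assume "p \<in> ?S" "q \<in> ?S"
      then show "p \<oplus>\<^bsub>poly_ring G\<^esub> q \<in> ?S"
        using R.a_closed[of p q] S(2) by simp
    qed (use S in auto)
  next
    fix p q :: "'k tpoly" assume pq: "p \<in> ?S" "q \<in> carrier (poly_ring G)"
    show "q \<otimes>\<^bsub>poly_ring G\<^esub> p \<in> ?S"
      unfolding poly_ring_simps(2) by (rule mult[OF pq])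
    show "p \<otimes>\<^bsub>poly_ring G\<^esub> q \<in> ?S"
      unfolding poly_ring_simps(2) mult.commute[of p q] by (rule mult[OF pq])
  qed
  then have "Idl\<^bsub>poly_ring G\<^esub> M \<subseteq> ?S"
    by (rule R.genideal_minimal) (use M in blast)
  then show ?thesis by blast
qed

lemma
  fixes M :: "'k::field tpoly set"
  assumes "M \<subseteq> carrier (poly_ring G)"
  shows genideal_poly_ring: "ideal (Idl\<^bsub>poly_ring G\<^esub> M) (poly_ring G)"
    and genideal_poly_ring_self: "M \<subseteq> Idl\<^bsub>poly_ring G\<^esub> M"
proof -
  interpret R: cring "poly_ring G :: 'k tpoly ring" by (rule cring_poly_ring)
  show "ideal (Idl\<^bsub>poly_ring G\<^esub> M) (poly_ring G)" by (rule R.genideal_ideal[OF assms])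
  show "M \<subseteq> Idl\<^bsub>poly_ring G\<^esub> M" by (rule R.genideal_self[OF assms])
qed

lemma genideal_poly_ring_minimal:
  fixes M I :: "'k::field tpoly set"
  assumes "ideal I (poly_ring G)" "M \<subseteq> I"
  shows "Idl\<^bsub>poly_ring G\<^esub> M \<subseteq> I"
proof -
  interpret R: cring "poly_ring G :: 'k tpoly ring" by (rule cring_poly_ring)
  show ?thesis by (rule R.genideal_minimal[OF assms])
qed

lemma monomial_ideal_keys:
  fixes f :: "'k::field tpoly"
  assumes A: "\<And>a. a \<in> A \<Longrightarrow> Poly_Mapping.keys a \<subseteq> G"
    and f: "f \<in> Idl\<^bsub>poly_ring G\<^esub> (monomial ` A)" and m: "m \<in> Poly_Mapping.keys f"
  shows "\<exists>a \<in> A. \<exists>c. m = a + c"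
proof -
  define S :: "'k tpoly set" where "S = {p. \<forall>m \<in> Poly_Mapping.keys p. \<exists>a \<in> A. \<exists>c. m = a + c}"
  have "Idl\<^bsub>poly_ring G\<^esub> (monomial ` A) \<subseteq> S"
  proof (rule genideal_poly_ring_subset)
    show "monomial ` A \<subseteq> S" unfolding S_def by (auto intro!: bexI exI[of _ 0])
    show "Poly_Mapping.single m c * p \<in> S" if p: "p \<in> S" for p m c
      unfolding S_def
    proof safe
      fix k assume "k \<in> Poly_Mapping.keys (Poly_Mapping.single m c * p)"
      then obtain x y where xy: "x \<in> Poly_Mapping.keys (Poly_Mapping.single m c)"
        "y \<in> Poly_Mapping.keys p" "k = x + y" by (rule keys_mult_mem)
      from p xy(2) obtain a d where "a \<in> A" "y = a + d" unfolding S_def by blast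
      then show "\<exists>a \<in> A. \<exists>c. k = a + c" using xy(3)
        by (intro bexI[of _ a] exI[of _ "d + x"]) (simp_all add: add_ac)
    qed
    show "p + q \<in> S" if "p \<in> S" "q \<in> S" for p q
      using that subsetD[OF Poly_Mapping.keys_add[of p q]] unfolding S_def by simp blast
    show "monomial ` A \<subseteq> carrier (poly_ring G)" by (simp add: image_subset_iff A)
  qed (simp_all add: S_def)
  with f m show ?thesis unfolding S_def by blast
qed

section \<open>Margins\<close>

definition weight :: "(point \<Rightarrow> nat) \<Rightarrow> expo \<Rightarrow> nat" where
  "weight w m = (\<Sum>u \<in> Poly_Mapping.keys m. w u * Poly_Mapping.lookup m u)"

lemma weight_add [simp]: "weight w (m + n) = weight w m + weight w n"
  unfolding weight_def
  by (rule setsum_keys_plus_distrib[where f = "\<lambda>u x. w u * x"]) (simp_all add: distrib_left)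

lemma weight_single [simp]: "weight w (Poly_Mapping.single u 1) = w u"
  by (simp add: weight_def)

lemma total_degree_weight: "total_degree m = weight (\<lambda>_. 1) m"
  by (simp add: total_degree_def weight_def)

lemma total_degree_add [simp]: "total_degree (m + n) = total_degree m + total_degree n"
  by (simp add: total_degree_weight)

lemma total_degree_eq_0_iff [simp]: "total_degree m = 0 \<longleftrightarrow> m = 0"
proof
  assume "total_degree m = 0"
  then have "\<forall>u \<in> Poly_Mapping.keys m. Poly_Mapping.lookup m u = 0"
    by (simp add: total_degree_def)
  then have "Poly_Mapping.keys m = {}" unfolding in_keys_iff by blast
  then show "m = 0" by simp
qed (simp add: total_degree_def)

text \<open>
  The margins of \<open>m\<close> are the images of the multiset \<open>m\<close> of points under the three coordinate
  projections.  They are compared by testing against all weights that depend on one coordinate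
  only: weights are additive in \<open>m\<close>, which makes the relation visibly compatible with
  multiplication of monomials.
\<close>

definition same_margins :: "expo \<Rightarrow> expo \<Rightarrow> bool" where
  "same_margins m n \<longleftrightarrow> (\<forall>a. weight (\<lambda>(i, j, k). a i) m = weight (\<lambda>(i, j, k). a i) n \<and>
    weight (\<lambda>(i, j, k). a j) m = weight (\<lambda>(i, j, k). a j) n \<and>
    weight (\<lambda>(i, j, k). a k) m = weight (\<lambda>(i, j, k). a k) n)"

lemma same_margins_refl [simp]: "same_margins m m"
  by (simp add: same_margins_def)

lemma same_margins_sym: "same_margins m n \<Longrightarrow> same_margins n m"
  by (simp add: same_margins_def)

lemma same_margins_trans: "same_margins l m \<Longrightarrow> same_margins m n \<Longrightarrow> same_margins l n"
  by (simp add: same_margins_def)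

lemma same_margins_add_left [simp]: "same_margins (c + m) (c + n) \<longleftrightarrow> same_margins m n"
  by (simp add: same_margins_def)

lemma same_margins_total_degree:
  assumes "same_margins m n"
  shows "total_degree m = total_degree n"
proof -
  have "weight (\<lambda>(i, j, k). (\<lambda>_. 1) i) m = weight (\<lambda>(i, j, k). (\<lambda>_. 1) i) n"
    using assms unfolding same_margins_def by (rule allE[of _ "\<lambda>_. 1"]) simp
  then show ?thesis by (simp add: total_degree_weight split_def)
qed

definition pair_expo :: "point \<Rightarrow> point \<Rightarrow> expo" where
  "pair_expo u v = Poly_Mapping.single u 1 + Poly_Mapping.single v 1"

lemma keys_pair_expo [simp]: "Poly_Mapping.keys (pair_expo u v) = {u, v}"
  by (auto simp: pair_expo_def keys_expo_add)

lemma weight_pair_expo [simp]: "weight w (pair_expo u v) = w u + w v"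
  by (simp only: pair_expo_def weight_add weight_single)

lemma total_degree_pair_expo [simp]: "total_degree (pair_expo u v) = 2"
  by (simp add: total_degree_weight)

lemma var_mult_var: "var u * var v = (monomial (pair_expo u v) :: 'k::field tpoly)"
  by (simp add: var_def pair_expo_def monomial_add)

lemma total_degree_2E:
  assumes "total_degree m = 2"
  obtains u v where "m = pair_expo u v"
proof -
  have split: "\<exists>u n. m = Poly_Mapping.single u 1 + n" if "m \<noteq> 0" for m :: expo
  proof -
    from that obtain u where u: "u \<in> Poly_Mapping.keys m" using keys_eq_empty by blast
    have "m = Poly_Mapping.single u 1 + (m - Poly_Mapping.single u 1)"
      by (rule poly_mapping_eqI)
        (use u in \<open>auto simp: lookup_add lookup_minus lookup_single when_def in_keys_iff\<close>)
    then show ?thesis by blast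
  qed
  have deg: "total_degree (Poly_Mapping.single u 1) = 1" for u by (simp only: total_degree_weight weight_single)
  from assms have "m \<noteq> 0" by (metis total_degree_eq_0_iff zero_neq_numeral)
  from split[OF this] obtain u n where n: "m = Poly_Mapping.single u 1 + n" by blast
  with assms deg have "total_degree n = 1" by simp
  then have "n \<noteq> 0" by (metis total_degree_eq_0_iff zero_neq_one)
  from split[OF this] obtain v l where l: "n = Poly_Mapping.single v 1 + l" by blast
  with \<open>total_degree n = 1\<close> deg have "total_degree l = 0" by simp
  then have "l = 0" by simp
  then show thesis using that n l by (simp add: pair_expo_def)
qed

lemma two_element_sums:
  fixes i j i' j' :: nat
  assumes "\<And>a :: nat \<Rightarrow> nat. a i + a j = a i' + a j'"
  shows "i' = i \<and> j' = j \<or> i' = j \<and> j' = i"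
proof -
  have count: "of_bool (i = x) + of_bool (j = x) = (of_bool (i' = x) + of_bool (j' = x) :: nat)" for x
    using assms[of "\<lambda>y. of_bool (y = x)"] .
  have "i' = i \<or> j' = i" by (rule ccontr) (use count[of i] in simp)
  moreover have "i' = j \<or> j' = j" by (rule ccontr) (use count[of j] in simp)
  moreover have "i' = i \<and> j' = i" if "i = j"
    by (rule ccontr) (use count[of i] that in \<open>auto simp: of_bool_def split: if_splits\<close>)
  ultimately show ?thesis by blast
qed
lemma same_margins_pair_cases:
  assumes "same_margins (pair_expo (i1, j1, k1) (i2, j2, k2)) (pair_expo (i1', j1', k1') (i2', j2', k2'))"
  shows "(i1' = i1 \<and> i2' = i2 \<or> i1' = i2 \<and> i2' = i1) \<and>
    (j1' = j1 \<and> j2' = j2 \<or> j1' = j2 \<and> j2' = j1) \<and>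
    (k1' = k1 \<and> k2' = k2 \<or> k1' = k2 \<and> k2' = k1)"
  using assms by (intro conjI two_element_sums) (simp_all add: same_margins_def)

section \<open>Minors\<close>

lemma minor_is_binomial:
  fixes p :: "'k::field tpoly"
  assumes "u \<in> G" "v \<in> G" "p \<in> {minor_x G u v, minor_y G u v, minor_z G u v}"
  shows "p = 0 \<or> (\<exists>u' \<in> G. \<exists>v' \<in> G. same_margins (pair_expo u v) (pair_expo u' v') \<and>
    p = monomial (pair_expo u v) - monomial (pair_expo u' v'))"
proof -
  obtain i1 j1 k1 i2 j2 k2 where uv: "u = (i1, j1, k1)" "v = (i2, j2, k2)"
    by (metis prod_cases3)
  have "p = 0 \<or>
    ((i2, j1, k1) \<in> G \<and> (i1, j2, k2) \<in> G \<and>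
      p = monomial (pair_expo u v) - monomial (pair_expo (i2, j1, k1) (i1, j2, k2))) \<or>
    ((i1, j2, k1) \<in> G \<and> (i2, j1, k2) \<in> G \<and>
      p = monomial (pair_expo u v) - monomial (pair_expo (i1, j2, k1) (i2, j1, k2))) \<or>
    ((i1, j1, k2) \<in> G \<and> (i2, j2, k1) \<in> G \<and>
      p = monomial (pair_expo u v) - monomial (pair_expo (i1, j1, k2) (i2, j2, k1)))"
    using assms(3) by (auto simp: uv var_mult_var split: if_splits)
  moreover have "same_margins (pair_expo u v) (pair_expo (i2, j1, k1) (i1, j2, k2))"
    "same_margins (pair_expo u v) (pair_expo (i1, j2, k1) (i2, j1, k2))"
    "same_margins (pair_expo u v) (pair_expo (i1, j1, k2) (i2, j2, k1))"
    by (simp_all add: uv same_margins_def)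
  ultimately show ?thesis by blast
qed

lemma pair_binomial_in_carrier:
  assumes "u \<in> G" "v \<in> G" "u' \<in> G" "v' \<in> G"
  shows "(monomial (pair_expo u v) - monomial (pair_expo u' v') :: 'k::field tpoly) \<in> carrier (poly_ring G)"
proof -
  have "Poly_Mapping.keys m \<subseteq> G"
    if "m \<in> Poly_Mapping.keys (monomial (pair_expo u v) - monomial (pair_expo u' v') :: 'k tpoly)" for m
    using subsetD[OF keys_minus_subset that] assms by auto
  then show ?thesis by simp
qed

lemma minors_in_carrier:
  "(\<Union>u \<in> G. \<Union>v \<in> G. {minor_x G u v, minor_y G u v, minor_z G u v :: 'k::field tpoly})
    \<subseteq> carrier (poly_ring G)"
proof
  fix p :: "'k tpoly" assume "p \<in> (\<Union>u \<in> G. \<Union>v \<in> G. {minor_x G u v, minor_y G u v, minor_z G u v})"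
  then obtain u v where uv: "u \<in> G" "v \<in> G" "p \<in> {minor_x G u v, minor_y G u v, minor_z G u v}"
    by blast
  show "p \<in> carrier (poly_ring G)"
    using minor_is_binomial[OF uv] pair_binomial_in_carrier[OF uv(1,2)] by fastforce
qed

lemma ideal_minors_ideal: "ideal (minors_ideal G :: 'k::field tpoly set) (poly_ring G)"
  unfolding minors_ideal_def by (rule genideal_poly_ring[OF minors_in_carrier])

lemmas minors_ideal_closed = ideal_poly_ring_closed[OF ideal_minors_ideal]

lemma minors_ideal_subset:
  fixes S :: "'k::field tpoly set"
  assumes "0 \<in> S" "\<And>p q. p \<in> S \<Longrightarrow> q \<in> S \<Longrightarrow> p + q \<in> S"
    and "\<And>p m c. p \<in> S \<Longrightarrow> Poly_Mapping.keys m \<subseteq> G \<Longrightarrow> Poly_Mapping.single m c * p \<in> S"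
    and binom: "\<And>u v u' v'. u \<in> G \<Longrightarrow> v \<in> G \<Longrightarrow> u' \<in> G \<Longrightarrow> v' \<in> G \<Longrightarrow>
      same_margins (pair_expo u v) (pair_expo u' v') \<Longrightarrow>
      monomial (pair_expo u v) - monomial (pair_expo u' v') \<in> S"
  shows "minors_ideal G \<subseteq> S"
  unfolding minors_ideal_def
proof (rule genideal_poly_ring_subset[OF minors_in_carrier])
  show "(\<Union>u \<in> G. \<Union>v \<in> G. {minor_x G u v, minor_y G u v, minor_z G u v}) \<subseteq> S"
  proof
    fix p :: "'k tpoly" assume "p \<in> (\<Union>u \<in> G. \<Union>v \<in> G. {minor_x G u v, minor_y G u v, minor_z G u v})"
    then obtain u v where uv: "u \<in> G" "v \<in> G" "p \<in> {minor_x G u v, minor_y G u v, minor_z G u v}"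
      by blast
    show "p \<in> S"
      using minor_is_binomial[OF uv] binom[OF uv(1,2)] assms(1) by blast
  qed
qed fact+

text \<open>
  Equal margins leave eight possibilities for \<open>(u', v')\<close>: each coordinate is switched or not.  Up
  to exchanging \<open>u'\<close> and \<open>v'\<close> these are four, namely no switch or a switch in exactly one
  coordinate.  Switching two coordinates is the same as switching the third one.
\<close>

lemma pair_binomial_in_minors_ideal:
  assumes G: "u \<in> G" "v \<in> G" "u' \<in> G" "v' \<in> G"
    and margins: "same_margins (pair_expo u v) (pair_expo u' v')"
  shows "(monomial (pair_expo u v) - monomial (pair_expo u' v') :: 'k::field tpoly) \<in> minors_ideal G"
proof -
  obtain i1 j1 k1 i2 j2 k2 where uv: "u = (i1, j1, k1)" "v = (i2, j2, k2)"
    by (metis prod_cases3)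
  obtain i1' j1' k1' i2' j2' k2' where uv': "u' = (i1', j1', k1')" "v' = (i2', j2', k2')"
    by (metis prod_cases3)
  have comm: "pair_expo a b = pair_expo b a" for a b
    by (simp add: pair_expo_def add.commute)
  let ?p = "monomial (pair_expo u v) - monomial (pair_expo u' v') :: 'k tpoly"
  have "?p \<in> {0, minor_x G u v, minor_y G u v, minor_z G u v}"
    using same_margins_pair_cases[OF margins[unfolded uv uv']] G
    unfolding uv uv' by (auto simp: var_mult_var comm)
  moreover have "{minor_x G u v, minor_y G u v, minor_z G u v :: 'k tpoly} \<subseteq> minors_ideal G"
    using genideal_poly_ring_self[OF minors_in_carrier[where 'k = 'k, of G]] G(1,2)
    unfolding minors_ideal_def by blast
  then have "{0, minor_x G u v, minor_y G u v, minor_z G u v :: 'k tpoly} \<subseteq> minors_ideal G"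
    by (simp add: minors_ideal_closed(1))
  ultimately show ?thesis by (rule rev_subsetD)
qed

lemma minors_ideal_mono:
  assumes "G \<subseteq> D"
  shows "(minors_ideal G :: 'k::field tpoly set) \<subseteq> minors_ideal D"
proof (rule minors_ideal_subset)
  show "Poly_Mapping.single m c * p \<in> minors_ideal D"
    if "p \<in> minors_ideal D" "Poly_Mapping.keys m \<subseteq> G" for p :: "'k tpoly" and m c
    using that assms by (intro minors_ideal_closed(3) single_in_carrier) auto
  show "0 \<in> (minors_ideal D :: 'k tpoly set)" by (rule minors_ideal_closed(1))
  show "p + q \<in> minors_ideal D" if "p \<in> minors_ideal D" "q \<in> minors_ideal D" for p q :: "'k tpoly"
    using that by (rule minors_ideal_closed(2))
  show "(monomial (pair_expo u v) - monomial (pair_expo u' v') :: 'k tpoly) \<in> minors_ideal D"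
    if "u \<in> G" "v \<in> G" "u' \<in> G" "v' \<in> G" "same_margins (pair_expo u v) (pair_expo u' v')" for u v u' v'
    using that assms by (blast intro: pair_binomial_in_minors_ideal)
qed

section \<open>Coefficient sums over monomials with equal margins\<close>

definition fibre_sum :: "expo \<Rightarrow> 'k::field tpoly \<Rightarrow> 'k" where
  "fibre_sum m p = (\<Sum>n \<in> Poly_Mapping.keys p. if same_margins m n then Poly_Mapping.lookup p n else 0)"

lemma fibre_sum_add: "fibre_sum m (p + q) = fibre_sum m p + fibre_sum m q"
  unfolding fibre_sum_def
  by (rule setsum_keys_plus_distrib[where f = "\<lambda>n x. if same_margins m n then x else 0"]) simp_all

lemma fibre_sum_zero [simp]: "fibre_sum m 0 = 0"
  by (simp add: fibre_sum_def)

lemma fibre_sum_single: "fibre_sum m (Poly_Mapping.single n c) = (if same_margins m n then c else 0)"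
  by (cases "c = 0") (simp_all add: fibre_sum_def)

lemma fibre_sum_diff: "fibre_sum m (p - q) = fibre_sum m p - fibre_sum m q"
  using fibre_sum_add[of m "p - q" q] by simp

text \<open>
  Multiplication by the monomial \<open>c\<close> maps the monomials with the margins of \<open>n\<close> bijectively onto
  the multiples of \<open>c\<close> with the margins of \<open>c + n\<close>, because margins are additive and cancellative.
\<close>

lemma fibre_sum_term_mult:
  assumes "fibre_sum n p = 0" "same_margins m (c + n)"
  shows "fibre_sum m (Poly_Mapping.single c a * p) = 0"
proof -
  have "same_margins m (c + l) \<longleftrightarrow> same_margins n l" for l
    using assms(2) same_margins_add_left same_margins_sym same_margins_trans by metis
  then have "fibre_sum m (Poly_Mapping.single c a * p) = a * fibre_sum n p"
    by (induction p rule: poly_mapping_additive_induct)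
      (simp_all add: fibre_sum_add fibre_sum_single mult_single distrib_left)
  then show ?thesis using assms(1) by simp
qed

lemma fibre_sum_eq_0_if_no_key:
  "(\<And>n. n \<in> Poly_Mapping.keys p \<Longrightarrow> \<not> same_margins m n) \<Longrightarrow> fibre_sum m p = 0"
  by (simp add: fibre_sum_def)

text \<open>
  The fibre sums are the coefficients of the image under the ring homomorphism
  \<open>T_{i,j,k} \<mapsto> x_i y_j z_k\<close>, so this says that the ideal of minors is contained in the toric ideal.
\<close>

lemma fibre_sum_minors_ideal:
  assumes "(f :: 'k::field tpoly) \<in> minors_ideal G"
  shows "fibre_sum m f = 0"
proof -
  have "minors_ideal G \<subseteq> {p :: 'k tpoly. \<forall>m. fibre_sum m p = 0}"
  proof (rule minors_ideal_subset)
    fix p :: "'k tpoly" and c a assume p: "p \<in> {p. \<forall>m. fibre_sum m p = 0}"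
    have "fibre_sum m (Poly_Mapping.single c a * p) = 0" for m
    proof (cases "\<exists>n. same_margins m (c + n)")
      case True
      with p show ?thesis using fibre_sum_term_mult by blast
    next
      case False
      show ?thesis
      proof (rule fibre_sum_eq_0_if_no_key)
        fix n assume "n \<in> Poly_Mapping.keys (Poly_Mapping.single c a * p)"
        then obtain x y where "x \<in> Poly_Mapping.keys (Poly_Mapping.single c a)" "n = x + y"
          by (rule keys_mult_mem)
        then show "\<not> same_margins m n" using False by (auto split: if_splits)
      qed
    qed
    then show "Poly_Mapping.single c a * p \<in> {p. \<forall>m. fibre_sum m p = 0}" by simp
  next
    fix u v u' v' assume "same_margins (pair_expo u v) (pair_expo u' v')"
    then have "same_margins m (pair_expo u v) \<longleftrightarrow> same_margins m (pair_expo u' v')" for m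
      using same_margins_sym same_margins_trans by blast
    then show "(monomial (pair_expo u v) - monomial (pair_expo u' v') :: 'k tpoly)
        \<in> {p. \<forall>m. fibre_sum m p = 0}"
      by (simp add: fibre_sum_diff monomial_def fibre_sum_single)
  qed (simp_all add: fibre_sum_add)
  with assms show ?thesis by blast
qed

lemma minors_ideal_other_key:
  assumes "(f :: 'k::field tpoly) \<in> minors_ideal G" "m \<in> Poly_Mapping.keys f"
  shows "\<exists>n \<in> Poly_Mapping.keys f. n \<noteq> m \<and> same_margins m n"
proof (rule ccontr)
  assume "\<not> ?thesis"
  then have "fibre_sum m f = (\<Sum>n \<in> Poly_Mapping.keys f. if n = m then Poly_Mapping.lookup f n else 0)"
    unfolding fibre_sum_def by (intro sum.cong) auto
  also have "\<dots> = Poly_Mapping.lookup f m" using assms(2) by simp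
  finally show False using fibre_sum_minors_ideal[OF assms(1), of m] assms(2) by (simp add: in_keys_iff)
qed

section \<open>Reducible quadratic monomials and the initial ideal\<close>

lemma lead_expo_in_keys: "p \<noteq> 0 \<Longrightarrow> lead_expo p \<in> Poly_Mapping.keys p"
  unfolding lead_expo_def by (rule Max_in) simp_all

lemma le_lead_expo: "m \<in> Poly_Mapping.keys p \<Longrightarrow> m \<le> lead_expo p"
  unfolding lead_expo_def by (rule Max_ge) simp_all

lemma keys_binomial:
  "r \<noteq> q \<Longrightarrow> Poly_Mapping.keys (monomial q - monomial r :: 'k::field tpoly) = {q, r}"
  by (auto simp: in_keys_iff lookup_minus lookup_monomial split: if_splits)

lemma lead_expo_binomial: "r < q \<Longrightarrow> lead_expo (monomial q - monomial r :: 'k::field tpoly) = q"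
  by (simp add: lead_expo_def keys_binomial max_absorb1 order_less_imp_le order_less_imp_not_eq)

definition reducible_pairs :: "point set \<Rightarrow> expo set" where
  "reducible_pairs G = {pair_expo u v | u v. u \<in> G \<and> v \<in> G \<and> (\<exists>u' \<in> G. \<exists>v' \<in> G.
    same_margins (pair_expo u v) (pair_expo u' v') \<and> pair_expo u' v' < pair_expo u v)}"

lemma reducible_pairsE:
  assumes "q \<in> reducible_pairs G"
  obtains u' v' where "u' \<in> G" "v' \<in> G" "same_margins q (pair_expo u' v')" "pair_expo u' v' < q"
    "monomial q - monomial (pair_expo u' v') \<in> (minors_ideal G :: 'k::field tpoly set)"
proof -
  from assms obtain u v u' v' where "u \<in> G" "v \<in> G" "u' \<in> G" "v' \<in> G" "q = pair_expo u v"
    "same_margins (pair_expo u v) (pair_expo u' v')" "pair_expo u' v' < pair_expo u v"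
    unfolding reducible_pairs_def by blast
  with that[of u' v'] show thesis by (auto intro: pair_binomial_in_minors_ideal)
qed

lemma reducible_pairs_total_degree: "q \<in> reducible_pairs G \<Longrightarrow> total_degree q = 2"
  by (auto simp: reducible_pairs_def)

lemma reducible_pairs_keys: "q \<in> reducible_pairs G \<Longrightarrow> Poly_Mapping.keys q \<subseteq> G"
  by (auto simp: reducible_pairs_def)

lemma finite_reducible_pairs: "finite G \<Longrightarrow> finite (reducible_pairs G)"
  by (rule finite_subset[of _ "(\<lambda>(u, v). pair_expo u v) ` (G \<times> G)"])
    (auto simp: reducible_pairs_def)

lemma reducible_pairs_mono: "G \<subseteq> D \<Longrightarrow> reducible_pairs G \<subseteq> reducible_pairs D"
  unfolding reducible_pairs_def by blast

text \<open>
  For an ideal of the polynomial ring over a finite \<open>G\<close> that contains \<open>minors_ideal G\<close>, this says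
  that the binomials \<open>T_u T_v - T_u' T_v'\<close> with equal margins and reducible leading term contain a
  Groebner basis of the ideal.
\<close>

definition leads_reducible :: "point set \<Rightarrow> 'k::field tpoly set \<Rightarrow> bool" where
  "leads_reducible G I \<longleftrightarrow> (\<forall>f \<in> I - {0}. \<exists>q \<in> reducible_pairs G. \<exists>c. lead_expo f = q + c)"

lemma reducible_pairs_in_carrier:
  "(monomial ` reducible_pairs G :: 'k::field tpoly set) \<subseteq> carrier (poly_ring G)"
  using reducible_pairs_keys by (simp add: image_subset_iff)

lemma lead_mons_in_carrier:
  assumes "I \<subseteq> carrier (poly_ring G)"
  shows "lead_mon ` (I - {0}) \<subseteq> carrier (poly_ring G)"
  using assms lead_expo_in_keys by (fastforce simp: lead_mon_def)

lemma lead_mon_in_reducible_ideal: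
  fixes I :: "'k::field tpoly set"
  assumes "leads_reducible G I" "I \<subseteq> carrier (poly_ring G)"
  shows "lead_mon ` (I - {0}) \<subseteq> Idl\<^bsub>poly_ring G\<^esub> (monomial ` reducible_pairs G)"
proof
  fix p assume "p \<in> lead_mon ` (I - {0})"
  then obtain f where f: "f \<in> I" "f \<noteq> 0" "p = monomial (lead_expo f)"
    by (auto simp: lead_mon_def)
  with assms(1) obtain q c where q: "q \<in> reducible_pairs G" "lead_expo f = q + c"
    unfolding leads_reducible_def by blast
  have "Poly_Mapping.keys (lead_expo f) \<subseteq> G"
    using f assms(2) lead_expo_in_keys[of f] by auto
  then have "(monomial c :: 'k tpoly) \<in> carrier (poly_ring G)"
    unfolding q(2) keys_expo_add by simp
  then have "monomial c * monomial q \<in> Idl\<^bsub>poly_ring G\<^esub> (monomial ` reducible_pairs G :: 'k tpoly set)"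
    using ideal_poly_ring_closed(3)[OF genideal_poly_ring[OF reducible_pairs_in_carrier]]
      genideal_poly_ring_self[OF reducible_pairs_in_carrier] q(1) by blast
  then show "p \<in> Idl\<^bsub>poly_ring G\<^esub> (monomial ` reducible_pairs G)"
    by (simp add: f(3) q(2) monomial_add mult.commute)
qed

lemma initial_ideal_reducible:
  assumes "leads_reducible G (minors_ideal G :: 'k::field tpoly set)"
  shows "initial_ideal G (minors_ideal G :: 'k tpoly set) = Idl\<^bsub>poly_ring G\<^esub> (monomial ` reducible_pairs G)"
proof
  note carr = minors_ideal_closed(5)[where 'k = 'k, of G]
  show "initial_ideal G (minors_ideal G :: 'k tpoly set) \<subseteq> Idl\<^bsub>poly_ring G\<^esub> (monomial ` reducible_pairs G)"
    unfolding initial_ideal_def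
    by (intro genideal_poly_ring_minimal genideal_poly_ring reducible_pairs_in_carrier
        lead_mon_in_reducible_ideal assms carr)
  have "monomial ` reducible_pairs G \<subseteq> lead_mon ` (minors_ideal G - {0 :: 'k tpoly})"
  proof
    fix p :: "'k tpoly" assume "p \<in> monomial ` reducible_pairs G"
    then obtain q where q: "p = monomial q" "q \<in> reducible_pairs G" by blast
    from q(2) obtain u' v' where r: "pair_expo u' v' < q"
      "monomial q - monomial (pair_expo u' v') \<in> (minors_ideal G :: 'k tpoly set)"
      by (rule reducible_pairsE)
    show "p \<in> lead_mon ` (minors_ideal G - {0})"
      by (rule image_eqI[of _ _ "monomial q - monomial (pair_expo u' v')"])
        (use r in \<open>auto simp: q lead_mon_def lead_expo_binomial\<close>)
  qed
  then show "Idl\<^bsub>poly_ring G\<^esub> (monomial ` reducible_pairs G) \<subseteq> initial_ideal G (minors_ideal G :: 'k tpoly set)"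
    unfolding initial_ideal_def
    using genideal_poly_ring_self[OF lead_mons_in_carrier[OF carr]]
    by (intro genideal_poly_ring_minimal genideal_poly_ring lead_mons_in_carrier carr) blast
qed

text \<open>
  Distinct monomials of equal degree do not divide each other, so none of them is redundant.
\<close>

lemma min_gens_equal_degree:
  assumes A: "\<And>a. a \<in> A \<Longrightarrow> Poly_Mapping.keys a \<subseteq> G" "\<And>a. a \<in> A \<Longrightarrow> total_degree a = d"
  shows "min_gens (Idl\<^bsub>poly_ring G\<^esub> (monomial ` A :: 'k::field tpoly set)) = monomial ` A"
proof -
  let ?J = "Idl\<^bsub>poly_ring G\<^esub> (monomial ` A :: 'k tpoly set)"
  have carr: "(monomial ` A :: 'k tpoly set) \<subseteq> carrier (poly_ring G)"
    by (simp add: image_subset_iff A)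
  note self = genideal_poly_ring_self[OF carr]
  have below: "\<exists>a \<in> A. \<exists>c. m = a + c" if "(monomial m :: 'k tpoly) \<in> ?J" for m
    using monomial_ideal_keys[OF A(1) that] by simp
  show ?thesis
  proof
    have "monomial ` A \<subseteq> (Set.range monomial :: 'k tpoly set)" by blast
    then show "min_gens ?J \<subseteq> monomial ` A" by (rule min_gens_minimal(2)[OF carr]) simp
    show "monomial ` A \<subseteq> min_gens ?J"
    proof
      fix p :: "'k tpoly" assume "p \<in> monomial ` A"
      then obtain a where a: "a \<in> A" "p = monomial a" by blast
      have "m' = a" if m': "(monomial m' :: 'k tpoly) \<in> ?J" "monomial m' dvd (monomial a :: 'k tpoly)" for m'
      proof -
        obtain b c where b: "b \<in> A" "m' = b + c" using below[OF m'(1)] by blast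
        obtain e where e: "a = m' + e" using m'(2) monomial_dvd_monomial_iff by blast
        have "total_degree a = total_degree b + total_degree c + total_degree e"
          by (simp add: e b(2))
        then have "total_degree e = 0" using A(2)[OF a(1)] A(2)[OF b(1)] by linarith
        then show ?thesis using e by simp
      qed
      then show "p \<in> min_gens ?J" using a self unfolding min_gens_def by blast
    qed
  qed
qed

lemma min_gens_initial_ideal:
  assumes "leads_reducible G (minors_ideal G :: 'k::field tpoly set)"
  shows "min_gens (initial_ideal G (minors_ideal G :: 'k tpoly set)) = monomial ` reducible_pairs G"
  unfolding initial_ideal_reducible[OF assms]
  by (rule min_gens_equal_degree[OF reducible_pairs_keys reducible_pairs_total_degree])

text \<open>
  Together with its converse \<open>leads_reducible_if_lex_quadratic\<close>, this replaces the existence of a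
  quadratic Groebner basis by a condition on leading monomials alone.
\<close>

lemma lex_quadratic_if_leads_reducible:
  assumes "finite G" and red: "leads_reducible G (minors_ideal G :: 'k::field tpoly set)"
  shows "lex_quadratic G (minors_ideal G :: 'k tpoly set)"
proof -
  have "\<exists>r. r < q \<and> total_degree r = 2 \<and> monomial q - monomial r \<in> (minors_ideal G :: 'k tpoly set)"
    if q: "q \<in> reducible_pairs G" for q
    by (rule reducible_pairsE[OF q, where 'k = 'k]) (metis total_degree_pair_expo)
  then obtain r where r: "\<And>q. q \<in> reducible_pairs G \<Longrightarrow> r q < q"
      "\<And>q. q \<in> reducible_pairs G \<Longrightarrow> total_degree (r q) = 2"
      "\<And>q. q \<in> reducible_pairs G \<Longrightarrow> monomial q - monomial (r q) \<in> (minors_ideal G :: 'k tpoly set)"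
    by metis
  define b :: "expo \<Rightarrow> 'k tpoly" where "b q = monomial q - monomial (r q)" for q
  have keys_b: "Poly_Mapping.keys (b q) = {q, r q}" if "q \<in> reducible_pairs G" for q
    unfolding b_def by (rule keys_binomial) (use r(1)[OF that] in auto)
  have lead_b: "lead_expo (b q) = q" if "q \<in> reducible_pairs G" for q
    unfolding b_def by (rule lead_expo_binomial[OF r(1)[OF that]])
  have nz: "b q \<noteq> 0" if "q \<in> reducible_pairs G" for q using keys_b[OF that] by auto
  have lead_mons: "lead_mon ` b ` reducible_pairs G = monomial ` reducible_pairs G"
    by (auto simp: lead_mon_def lead_b image_image)
  have "groebner_basis G (minors_ideal G) (b ` reducible_pairs G)"
    unfolding groebner_basis_def lead_mons initial_ideal_reducible[OF red]
    using finite_reducible_pairs[OF assms(1)] r(3) nz by (auto simp: b_def)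
  moreover have "Poly_Mapping.lookup (b q) (lead_expo (b q)) = 1" if q: "q \<in> reducible_pairs G" for q
    unfolding lead_b[OF q] using r(1)[OF q] by (simp add: b_def lookup_minus lookup_monomial)
  moreover have "q = q'" if q: "q \<in> reducible_pairs G" "q' \<in> reducible_pairs G"
    and dvd: "lead_mon (b q') dvd lead_mon (b q)" for q q'
  proof -
    from dvd obtain c where c: "q = q' + c"
      unfolding lead_mon_def lead_b[OF q(1)] lead_b[OF q(2)] monomial_dvd_monomial_iff by blast
    then have "total_degree q = total_degree q' + total_degree c" by simp
    then have "total_degree c = 0" using reducible_pairs_total_degree q by (metis add_cancel_left_right)
    then show ?thesis using c by simp
  qed
  ultimately have "minimal_groebner_basis G (minors_ideal G) (b ` reducible_pairs G)"
    unfolding minimal_groebner_basis_def by blast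
  moreover have "quadratic (b q)" if q: "q \<in> reducible_pairs G" for q
    unfolding quadratic_def keys_b[OF q]
    using nz[OF q] r(2)[OF q] reducible_pairs_total_degree[OF q] by simp
  ultimately show ?thesis unfolding lex_quadratic_def by blast
qed

text \<open>
  The leading monomial has a companion with the same margins in \<open>g\<close>.  The companion is smaller,
  because it is not leading, and quadratic, because margins determine the degree.
\<close>

lemma lead_in_reducible_pairs:
  assumes g: "(g :: 'k::field tpoly) \<in> minors_ideal G" "g \<noteq> 0" and deg: "total_degree (lead_expo g) = 2"
  shows "lead_expo g \<in> reducible_pairs G"
proof -
  have carr: "Poly_Mapping.keys m \<subseteq> G" if "m \<in> Poly_Mapping.keys g" for m
    using g(1) minors_ideal_closed(5)[of G] that by auto
  obtain n where n: "n \<in> Poly_Mapping.keys g" "n \<noteq> lead_expo g" "same_margins (lead_expo g) n"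
    using minors_ideal_other_key[OF g(1) lead_expo_in_keys[OF g(2)]] by blast
  obtain u v where uv: "lead_expo g = pair_expo u v" using deg by (rule total_degree_2E)
  obtain u' v' where uv': "n = pair_expo u' v'"
    using total_degree_2E[of n] same_margins_total_degree[OF n(3)] deg by metis
  have "n < lead_expo g" using n(2) le_lead_expo[OF n(1)] by simp
  moreover have "u \<in> G" "v \<in> G" "u' \<in> G" "v' \<in> G"
    using carr[OF n(1)] carr[OF lead_expo_in_keys[OF g(2)]] unfolding uv uv' by simp_all
  ultimately show ?thesis
    using n(3) unfolding reducible_pairs_def uv uv' by blast
qed

lemma leads_reducible_if_lex_quadratic:
  assumes "lex_quadratic G (minors_ideal G :: 'k::field tpoly set)"
  shows "leads_reducible G (minors_ideal G :: 'k tpoly set)"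
  unfolding leads_reducible_def
proof
  fix f :: "'k tpoly" assume f: "f \<in> minors_ideal G - {0}"
  note carr = minors_ideal_closed(5)[where 'k = 'k, of G]
  obtain B where B: "minimal_groebner_basis G (minors_ideal G) B" "\<And>g :: 'k tpoly. g \<in> B \<Longrightarrow> quadratic g"
    using assms unfolding lex_quadratic_def by blast
  then have BI: "B \<subseteq> minors_ideal G - {0}"
    and in_B: "Idl\<^bsub>poly_ring G\<^esub> (lead_mon ` B) = initial_ideal G (minors_ideal G)"
    unfolding minimal_groebner_basis_def groebner_basis_def by blast+
  have "monomial (lead_expo f) \<in> initial_ideal G (minors_ideal G :: 'k tpoly set)"
    unfolding initial_ideal_def
    using genideal_poly_ring_self[OF lead_mons_in_carrier[OF carr]] f by (auto simp: lead_mon_def)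
  then have "monomial (lead_expo f) \<in> Idl\<^bsub>poly_ring G\<^esub> (monomial ` lead_expo ` B :: 'k tpoly set)"
    unfolding in_B[symmetric] by (simp add: lead_mon_def image_image)
  moreover have "Poly_Mapping.keys a \<subseteq> G" if "a \<in> lead_expo ` B" for a
    using that BI carr lead_expo_in_keys by fastforce
  ultimately have "\<exists>a \<in> lead_expo ` B. \<exists>c. lead_expo f = a + c"
    by (intro monomial_ideal_keys[where f = "monomial (lead_expo f) :: 'k tpoly"]) auto
  then obtain g c where g: "g \<in> B" "lead_expo f = lead_expo g + c" by blast
  have "lead_expo g \<in> reducible_pairs G"
  proof (rule lead_in_reducible_pairs)
    show "total_degree (lead_expo g) = 2"
      using B(2)[OF g(1)] lead_expo_in_keys[of g] unfolding quadratic_def by blast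
  qed (use g(1) BI in auto)
  with g(2) show "\<exists>q \<in> reducible_pairs G. \<exists>c. lead_expo f = q + c" by blast
qed

section \<open>Restriction to a subset of the points\<close>

lemma finite_bounded_total_degree:
  assumes "finite G"
  shows "finite {m. Poly_Mapping.keys m \<subseteq> G \<and> total_degree m \<le> N}" (is "finite ?E")
proof (rule finite_imageD)
  have le: "Poly_Mapping.lookup m u \<le> N" if "total_degree m \<le> N" for m u
  proof (cases "u \<in> Poly_Mapping.keys m")
    case True
    then have "Poly_Mapping.lookup m u \<le> total_degree m"
      unfolding total_degree_def by (intro member_le_sum) simp_all
    with that show ?thesis by simp
  qed (simp add: in_keys_iff)
  have out: "Poly_Mapping.lookup m u = 0" if "Poly_Mapping.keys m \<subseteq> G" "u \<notin> G" for m :: expo and u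
    using that by (auto simp: in_keys_iff)
  have "Poly_Mapping.lookup ` ?E \<subseteq> {f. \<forall>u. (u \<in> G \<longrightarrow> f u \<in> {..N}) \<and> (u \<notin> G \<longrightarrow> f u = 0)}"
  proof (rule image_subsetI)
    fix m assume "m \<in> ?E"
    then show "Poly_Mapping.lookup m \<in> {f. \<forall>u. (u \<in> G \<longrightarrow> f u \<in> {..N}) \<and> (u \<notin> G \<longrightarrow> f u = 0)}"
      using le out by (simp del: split_paired_All)
  qed
  then show "finite (Poly_Mapping.lookup ` ?E)"
    by (rule finite_subset) (rule finite_set_of_finite_funs[OF assms finite_atMost])
  show "inj_on Poly_Mapping.lookup ?E" by (rule inj_onI) (rule iffD2[OF poly_mapping_eq_iff])
qed

text \<open>
  Division by the binomials with reducible leading term.  Each step replaces the leading monomial by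
  a smaller one of the same degree over \<open>G\<close>.  So all monomials that occur stay in the finite set
  \<open>E\<close> of monomials over \<open>G\<close> whose degree does not exceed that of the polynomial divided, and the
  process stops without an appeal to the well-foundedness of the monomial order.
\<close>

lemma subset_minors_ideal_if_leads_reducible:
  fixes I :: "'k::field tpoly set"
  assumes "finite G" and red: "leads_reducible G I" and carr: "I \<subseteq> carrier (poly_ring G)"
    and sub: "\<And>f g. f \<in> I \<Longrightarrow> g \<in> minors_ideal G \<Longrightarrow> f - g \<in> I"
  shows "I \<subseteq> minors_ideal G"
proof
  fix f assume f: "f \<in> I"
  define E where "E = {m. Poly_Mapping.keys m \<subseteq> G \<and> total_degree m \<le> Max (total_degree ` Poly_Mapping.keys f)}"
  have finE: "finite E" unfolding E_def by (rule finite_bounded_total_degree[OF assms(1)])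
  \<comment> \<open>The measure counts the elements of \<open>E\<close> up to the leading monomial; phrased through the keys of
    \<open>g\<close>, it also covers \<open>g = 0\<close>, where \<open>lead_expo\<close> means nothing.\<close>
  have "g \<in> minors_ideal G" if "g \<in> I" "Poly_Mapping.keys g \<subseteq> E" for g
    using that
  proof (induction "card {e \<in> E. \<exists>k \<in> Poly_Mapping.keys g. e \<le> k}" arbitrary: g rule: less_induct)
    case less
    show ?case
    proof (cases "g = 0")
      case True
      then show ?thesis by (simp add: minors_ideal_closed(1))
    next
      case False
      define l where "l = lead_expo g"
      have l: "l \<in> Poly_Mapping.keys g" "\<And>k. k \<in> Poly_Mapping.keys g \<Longrightarrow> k \<le> l"
        unfolding l_def using lead_expo_in_keys[OF False] le_lead_expo by blast+
      obtain q c where q: "q \<in> reducible_pairs G" "l = q + c"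
        using red less.prems(1) False unfolding leads_reducible_def l_def by blast
      obtain u v where uv: "u \<in> G" "v \<in> G" "same_margins q (pair_expo u v)" "pair_expo u v < q"
        "monomial q - monomial (pair_expo u v) \<in> (minors_ideal G :: 'k tpoly set)"
        using q(1) by (rule reducible_pairsE)
      define r where "r = pair_expo u v + c"
      have "r < l" unfolding r_def q(2) using uv(4) by (rule add_strict_right_mono)
      have lE: "l \<in> E" using l(1) less.prems(2) by blast
      have "total_degree r = total_degree l"
        using same_margins_total_degree[OF uv(3)] by (simp add: r_def q(2))
      then have rE: "r \<in> E" using lE uv(1,2) by (simp add: E_def q(2) r_def keys_expo_add)
      define t where "t = Poly_Mapping.single c (Poly_Mapping.lookup g l) * (monomial q - monomial (pair_expo u v))"
      have "Poly_Mapping.keys c \<subseteq> G" using lE by (simp add: E_def q(2) keys_expo_add)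
      then have tJ: "t \<in> minors_ideal G"
        unfolding t_def by (intro minors_ideal_closed(3) uv(5) single_in_carrier)
      have t: "t = Poly_Mapping.single l (Poly_Mapping.lookup g l) - Poly_Mapping.single r (Poly_Mapping.lookup g l)"
        by (simp add: t_def monomial_def right_diff_distrib mult_single q(2) r_def add.commute)
      have keys: "k \<in> E \<and> k < l" if k: "k \<in> Poly_Mapping.keys (g - t)" for k
      proof (cases "k = r")
        case True
        then show ?thesis using rE \<open>r < l\<close> by simp
      next
        case False
        then have "k \<noteq> l" "k \<in> Poly_Mapping.keys g"
          using k \<open>r < l\<close> by (auto simp: t in_keys_iff lookup_minus lookup_single when_def split: if_splits)
        then show ?thesis using l(2)[of k] less.prems(2) by auto
      qed
      have "g - t \<in> minors_ideal G"
      proof (rule less.hyps)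
        have "{e \<in> E. \<exists>k \<in> Poly_Mapping.keys (g - t). e \<le> k} \<subset> {e \<in> E. \<exists>k \<in> Poly_Mapping.keys g. e \<le> k}"
          (is "?A \<subset> ?B")
        proof
          show "?A \<subseteq> ?B" using keys l(1) order_le_less_trans less_imp_le by blast
          have "l \<in> ?B" using lE l(1) by blast
          moreover have "l \<notin> ?A" using keys leD by blast
          ultimately show "?A \<noteq> ?B" by blast
        qed
        then show "card ?A < card ?B" by (rule psubset_card_mono[rotated]) (simp add: finE)
        show "g - t \<in> I" by (rule sub[OF less.prems(1) tJ])
        show "Poly_Mapping.keys (g - t) \<subseteq> E" using keys by blast
      qed
      from minors_ideal_closed(2)[OF this tJ] show ?thesis by simp
    qed
  qed
  moreover have "Poly_Mapping.keys f \<subseteq> E" using f carr by (auto simp: E_def)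
  ultimately show "f \<in> minors_ideal G" using f by blast
qed

text \<open>
  Let \<open>T_a T_b\<close> be reducible to \<open>T_c T_d\<close>, with \<open>a\<close> and \<open>b\<close> in \<open>G\<close>.  The detaching condition puts
  \<open>c\<close> and \<open>d\<close> into \<open>G\<close> at once.  Under the leading monomial condition, the removed point \<open>u\<close> can
  occur in \<open>T_c T_d\<close> only as a product \<open>T_u T_v\<close> that is the leading monomial of its difference with
  \<open>T_a T_b\<close>, contrary to \<open>T_c T_d\<close> being the smaller one; and \<open>T_u T_u\<close> is ruled out because no
  other monomial has its margins.
\<close>

lemma reducible_pairs_restrict:
  assumes "G \<subseteq> D"
    and "detaching_condition TYPE('k::field) D G \<or> leading_monomial_condition TYPE('k) D G"
    and q: "q \<in> reducible_pairs D" "Poly_Mapping.keys q \<subseteq> G"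
  shows "q \<in> reducible_pairs G"
proof -
  from q obtain a b c d where ab: "q = pair_expo a b" "a \<in> G" "b \<in> G" and cd: "c \<in> D" "d \<in> D"
    "same_margins (pair_expo a b) (pair_expo c d)" "pair_expo c d < pair_expo a b"
    unfolding reducible_pairs_def by auto
  have abD: "a \<in> D" "b \<in> D" using ab assms(1) by blast+
  from assms(2) have "c \<in> G \<and> d \<in> G"
  proof
    assume "detaching_condition TYPE('k) D G"
    moreover have "var a * var b - var c * var d \<in> (minors_ideal D :: 'k tpoly set)"
      unfolding var_mult_var using abD cd(1-3) by (rule pair_binomial_in_minors_ideal)
    ultimately show ?thesis using ab(2,3) cd(1,2) unfolding detaching_condition_def by blast
  next
    assume "leading_monomial_condition TYPE('k) D G"
    then obtain u where u: "G = D - {u}" and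
      lead: "\<And>v u' v'. v \<in> G \<Longrightarrow> u' \<in> D \<Longrightarrow> v' \<in> D \<Longrightarrow>
        var u * var v - var u' * var v' \<in> (minors_ideal D :: 'k tpoly set) \<Longrightarrow>
        var u * var v - var u' * var v' \<noteq> (0 :: 'k tpoly) \<Longrightarrow>
        lead_mon (var u * var v - var u' * var v') = (var u * var v :: 'k tpoly)"
      unfolding leading_monomial_condition_def by blast
    have not_below: False if v: "u \<in> D" "v \<in> D" "same_margins (pair_expo a b) (pair_expo u v)" "pair_expo u v < pair_expo a b" for v
    proof (cases "v = u")
      case True
      \<comment> \<open>All margins of \<open>T_u T_u\<close> consist of one coordinate repeated, which forces \<open>a = b = u\<close>.\<close>
      obtain i1 j1 k1 i2 j2 k2 where ab': "a = (i1, j1, k1)" "b = (i2, j2, k2)"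
        by (metis prod_cases3)
      obtain i j k where u': "u = (i, j, k)" by (metis prod_cases3)
      have "a = u" using same_margins_pair_cases[OF v(3)[unfolded ab' u' True]] ab' u' by auto
      then show False using ab(2) u by blast
    next
      case False
      then have vG: "v \<in> G" using u v(2) by blast
      let ?p = "var u * var v - var a * var b :: 'k tpoly"
      have p: "?p = - (monomial (pair_expo a b) - monomial (pair_expo u v))"
        by (simp add: var_mult_var)
      have "?p \<in> minors_ideal D"
        unfolding var_mult_var using v(1,2) abD same_margins_sym[OF v(3)]
        by (rule pair_binomial_in_minors_ideal)
      moreover have "?p \<noteq> 0" using v(4) by (auto simp: var_mult_var)
      ultimately have "lead_mon ?p = monomial (pair_expo u v)"
        using lead[OF vG abD] by (simp add: var_mult_var)
      moreover have "lead_expo ?p = pair_expo a b"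
        using lead_expo_binomial[OF v(4), where 'k = 'k] by (simp only: p lead_expo_def keys_minus)
      ultimately show False using v(4) by (simp add: lead_mon_def)
    qed
    have "pair_expo c d = pair_expo d c" by (simp add: pair_expo_def add.commute)
    then have "c \<noteq> u" "d \<noteq> u" using not_below[of d] not_below[of c] cd by auto
    then show ?thesis using u cd(1,2) by blast
  qed
  then show ?thesis using ab cd(3,4) unfolding reducible_pairs_def by blast
qed

theorem proposition2p17:
  fixes D G :: "point set"
  assumes "finite D"
    and "lex_quadratic D (minors_ideal D :: 'k::field_char_0 tpoly set)"
    and "G \<subseteq> D"
    and "detaching_condition TYPE('k) D G \<or> leading_monomial_condition TYPE('k) D G"
  shows "minors_ideal D \<inter> carrier (poly_ring G) = (minors_ideal G :: 'k tpoly set) \<and>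
    min_gens (initial_ideal D (minors_ideal D)) \<inter> carrier (poly_ring G)
      = min_gens (initial_ideal G (minors_ideal G :: 'k tpoly set)) \<and>
    lex_quadratic G (minors_ideal G :: 'k tpoly set)"
proof -
  let ?I = "minors_ideal D \<inter> carrier (poly_ring G) :: 'k tpoly set"
  note restrict = reducible_pairs_restrict[OF assms(3,4)]
  have fin: "finite G" using assms(1,3) by (rule finite_subset[rotated])
  have redD: "leads_reducible D (minors_ideal D :: 'k tpoly set)"
    by (rule leads_reducible_if_lex_quadratic[OF assms(2)])
  have JI: "minors_ideal G \<subseteq> ?I"
    using minors_ideal_mono[OF assms(3)] minors_ideal_closed(5) by blast
  have redI: "leads_reducible G ?I"
    unfolding leads_reducible_def
  proof
    fix f assume f: "f \<in> ?I - {0}"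
    then obtain q c where q: "q \<in> reducible_pairs D" "lead_expo f = q + c"
      using redD unfolding leads_reducible_def by blast
    have "Poly_Mapping.keys (lead_expo f) \<subseteq> G" using f lead_expo_in_keys[of f] by auto
    then have "q \<in> reducible_pairs G"
      by (intro restrict q(1)) (simp add: q(2) keys_expo_add)
    with q(2) show "\<exists>q \<in> reducible_pairs G. \<exists>c. lead_expo f = q + c" by blast
  qed
  have "?I \<subseteq> minors_ideal G"
  proof (rule subset_minors_ideal_if_leads_reducible[OF fin redI])
    fix f g assume f: "f \<in> ?I" and g: "g \<in> (minors_ideal G :: 'k tpoly set)"
    have g': "g \<in> ?I" using g JI by blast
    have "f - g \<in> minors_ideal D" using f g' by (intro minors_ideal_closed(4)) auto
    moreover have "Poly_Mapping.keys m \<subseteq> G" if "m \<in> Poly_Mapping.keys (f - g)" for m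
      using subsetD[OF keys_minus_subset that] f g' by auto
    ultimately show "f - g \<in> ?I" by simp
  qed simp
  with JI have eq: "?I = minors_ideal G" by blast
  have redG: "leads_reducible G (minors_ideal G :: 'k tpoly set)" using redI unfolding eq .
  have pairs: "reducible_pairs G = {q \<in> reducible_pairs D. Poly_Mapping.keys q \<subseteq> G}"
    using restrict reducible_pairs_mono[OF assms(3)] reducible_pairs_keys by blast
  have "min_gens (initial_ideal D (minors_ideal D)) \<inter> carrier (poly_ring G)
      = min_gens (initial_ideal G (minors_ideal G :: 'k tpoly set))"
    unfolding min_gens_initial_ideal[OF redD] min_gens_initial_ideal[OF redG] pairs by auto
  then show ?thesis using eq lex_quadratic_if_leads_reducible[OF fin redG] by blast
qed

end
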